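(* Let $\mathcal{A}_{[m]}$ be the set of the top-$m$ users who own the largest expressed opinions without perturbation, that is, $\mathcal{A}_{[m]}=\{u_{[1]},u_{[2]},\dots,u_{[m]}\}$ with $z^*(u_{[1]})\ge z^*(u_{[2]})\ge\dots\ge z^*(u_{[m]})\ge z^*(v)$ for any $v\notin\mathcal{A}_{[m]}$. Then the optimal attacker set $\mathcal{A}^*$ satisfies $\mathcal{A}^*\subseteq\mathcal{A}_{[m]}$.
   Context: There are $n$ users $\mathcal{V}=\{1,\dots,n\}$, and $1\le m\le n$ and $k\ge1$ are integers (the maximal number of attackers, and of target users per attacker). $\mathbf{W}\in\mathbb{R}^{n\times n}$ is entrywise nonnegative with $\mathbf{W}\mathbf{1}=\mathbf{1}$, where $\mathbf{1}$ is the all-ones vector. $\mathbf{A}=\mathrm{Diag}(\alpha_1,\dots,\alpha_n)$ with $0<\alpha_i<1$, and $\mathbf{s}\in\mathbb{R}^n$ is the vector of internal opinions. $\mathbf{I}$ is the identity matrix and $\mathbf{B}=[\mathbf{I}-(\mathbf{I}-\mathbf{A})\mathbf{W}]^{-1}$. The equilibrium expressed opinions without perturbation are $\mathbf{z}^*=\mathbf{B}\mathbf{A}\mathbf{s}$, with $u$-th entry $z^*(u)$. Define $\mathbf{c}_1=(\mathbf{1}^T\mathbf{B}(\mathbf{I}-\mathbf{A}))^T$ and $\mathbf{c}_2=\mathbf{W}\mathbf{z}^*$, with entries $c_1(v)$, $c_2(v)$. The optimal individual influence of user $u$ is $$\delta_u^*=\max_{\mathcal{T}_u\subseteq\mathcal{V},\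 |\mathcal{T}_u|\le k}\ \sum_{v\in\mathcal{T}_u}c_1(v)\,\big(z^*(u)-c_2(v)\big),$$ where the empty sum is $0$. The optimal attacker set $\mathcal{A}^*$ is the solution of $$\max_{\mathcal{A}\subseteq\mathcal{V},\ |\mathcal{A}|\le m}\ \sum_{u\in\mathcal{A}}\delta_u^*.$$
   Formalization: Neither set need be unique and the claim fails for some optimal sets (e.g. constant s), so it is proved that every top-m set contains some optimal attacker set, and that every optimal attacker set whose members all have positive δ* lies in some top-m set. *)

theory Defs
  imports "HOL-Analysis.Analysis"
begin

definition diag_mat :: "real ^ 'n \<Rightarrow> real ^ 'n ^ 'n" where
  "diag_mat a = (\<chi> i j. if i = j then a $ i else 0)"

text \<open>The inverse is the library's \<open>matrix_inv\<close>, which is meaningful only for an invertible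
  matrix; invertibility is not assumed, as it follows from \<open>W\<close> being row-stochastic and
  \<open>0 < \<alpha> i < 1\<close>.\<close>

definition B_mat :: "real ^ 'n ^ 'n \<Rightarrow> real ^ 'n \<Rightarrow> real ^ 'n ^ 'n" where
  "B_mat W \<alpha> = matrix_inv (mat 1 - (mat 1 - diag_mat \<alpha>) ** W)"

definition expressed :: "real ^ 'n ^ 'n \<Rightarrow> real ^ 'n \<Rightarrow> real ^ 'n \<Rightarrow> real ^ 'n" where
  "expressed W \<alpha> s = (B_mat W \<alpha> ** diag_mat \<alpha>) *v s"

text \<open>\<open>1\<close> is the all-ones vector, and \<open>x v* M\<close> is the transpose of the row vector
  \<open>x\<^sup>T M\<close>.\<close>

definition c1 :: "real ^ 'n ^ 'n \<Rightarrow> real ^ 'n \<Rightarrow> real ^ 'n" where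
  "c1 W \<alpha> = 1 v* (B_mat W \<alpha> ** (mat 1 - diag_mat \<alpha>))"

definition c2 :: "real ^ 'n ^ 'n \<Rightarrow> real ^ 'n \<Rightarrow> real ^ 'n \<Rightarrow> real ^ 'n" where
  "c2 W \<alpha> s = W *v expressed W \<alpha> s"

definition influence ::
  "real ^ 'n ^ 'n \<Rightarrow> real ^ 'n \<Rightarrow> real ^ 'n \<Rightarrow> nat \<Rightarrow> 'n \<Rightarrow> real" where
  "influence W \<alpha> s k u =
     Max ((\<lambda>T. \<Sum>v\<in>T. c1 W \<alpha> $ v * (expressed W \<alpha> s $ u - c2 W \<alpha> s $ v)) ` {T. card T \<le> k})"

definition optimal_attackers ::
  "real ^ 'n ^ 'n \<Rightarrow> real ^ 'n \<Rightarrow> real ^ 'n \<Rightarrow> nat \<Rightarrow> nat \<Rightarrow> 'n set \<Rightarrow> bool" where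
  "optimal_attackers W \<alpha> s k m A \<longleftrightarrow>
     is_arg_max (\<lambda>A. \<Sum>u\<in>A. influence W \<alpha> s k u) (\<lambda>A. card A \<le> m) A"

text \<open>The list \<open>us\<close> is an enumeration in nonincreasing order of \<open>z\<close>.  Because of ties there may
  be several such sets \<open>S\<close>.  Only \<open>m \<ge> 1\<close> is meaningful.\<close>

definition top_users :: "real ^ 'n \<Rightarrow> nat \<Rightarrow> 'n set \<Rightarrow> bool" where
  "top_users z m S \<longleftrightarrow>
     (\<exists>us. length us = m \<and> distinct us \<and> set us = S \<and>
           sorted_wrt (\<lambda>u v. z $ u \<ge> z $ v) us \<and>
           (\<forall>v. v \<notin> S \<longrightarrow> z $ (last us) \<ge> z $ v))"

end

theory Submission
  imports Defs
begin

text \<open>All entries of \<open>c1\<close> are positive, because \<open>1\<^sup>T B\<close> solves \<open>y = 1 + y P\<close> with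
  \<open>P = (I - A) W\<close> nonnegative with row sums below \<open>1\<close>, which forces \<open>y \<ge> 1\<close>.  Hence the influence of
  a user is a nonnegative nondecreasing function of the expressed opinion, strictly increasing
  where it is positive.  An exchange argument does the rest.\<close>

section \<open>Positivity of the weights\<close>

lemma diag_mat_mult: "(diag_mat a ** M) $ i $ j = a $ i * M $ i $ j"
  by (simp add: diag_mat_def matrix_matrix_mult_def if_distrib if_distribR cong: if_cong)

lemma mult_diag_mat: "(M ** diag_mat a) $ i $ j = M $ i $ j * a $ j"
  by (simp add: diag_mat_def matrix_matrix_mult_def if_distrib if_distribR cong: if_cong)

lemma mat_1_minus_diag_mat: "mat 1 - diag_mat a = diag_mat (1 - a)"
  by (simp add: diag_mat_def mat_def vec_eq_iff)

text \<open>Summing the hypothesis over \<open>j\<close> gives \<open>\<Sum>\<^sub>i y i \<le> \<Sum>\<^sub>i y i r i\<close> with row sums \<open>r i < 1\<close>.\<close>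

lemma substochastic_subinvariant_zero:
  fixes P :: "'n::finite \<Rightarrow> 'n \<Rightarrow> real"
  assumes row: "\<And>i. (\<Sum>j\<in>UNIV. P i j) < 1"
    and nonneg: "\<And>i. 0 \<le> y i" and sub: "\<And>j. y j \<le> (\<Sum>i\<in>UNIV. y i * P i j)"
  shows "y i = 0"
proof -
  have "(\<Sum>j\<in>UNIV. y j) \<le> (\<Sum>j\<in>UNIV. \<Sum>i\<in>UNIV. y i * P i j)"
    by (intro sum_mono sub)
  also have "\<dots> = (\<Sum>i\<in>UNIV. \<Sum>j\<in>UNIV. y i * P i j)"
    by (rule sum.swap)
  also have "\<dots> = (\<Sum>i\<in>UNIV. y i * (\<Sum>j\<in>UNIV. P i j))"
    by (simp add: sum_distrib_left)
  finally have "(\<Sum>i\<in>UNIV. y i * (1 - (\<Sum>j\<in>UNIV. P i j))) \<le> 0"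
    by (simp add: algebra_simps sum_subtractf)
  moreover have ge: "0 \<le> y i * (1 - (\<Sum>j\<in>UNIV. P i j))" for i
    using row[of i] nonneg[of i] by simp
  ultimately have "(\<Sum>i\<in>UNIV. y i * (1 - (\<Sum>j\<in>UNIV. P i j))) = 0"
    by (meson order_antisym sum_nonneg)
  then have "y i * (1 - (\<Sum>j\<in>UNIV. P i j)) = 0"
    using ge by (simp add: sum_nonneg_eq_0_iff)
  with row[of i] show ?thesis by auto
qed

context
  fixes P :: "real ^ 'n ^ 'n"
  assumes P_nonneg: "\<And>i j. 0 \<le> P $ i $ j"
    and P_row: "\<And>i. (\<Sum>j\<in>UNIV. P $ i $ j) < 1"
begin

lemma vector_mult_one_minus: "(y v* (mat 1 - P)) $ j = y $ j - (\<Sum>i\<in>UNIV. y $ i * P $ i $ j)"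
proof -
  have "(y v* (mat 1 - P)) $ j = (\<Sum>i\<in>UNIV. y $ i * ((if i = j then 1 else 0) - P $ i $ j))"
    by (simp add: vector_matrix_mult_def mat_def mult.commute)
  also have "\<dots> = (\<Sum>i\<in>UNIV. (if i = j then y $ i else 0) - y $ i * P $ i $ j)"
    by (intro sum.cong) (auto simp: algebra_simps)
  finally show ?thesis by (simp add: sum_subtractf)
qed

text \<open>A left kernel vector satisfies \<open>y = y v* P\<close>. Taking absolute values
  entrywise keeps \<open>\<le>\<close> because \<open>P\<close> is nonnegative, so the previous
  lemma on subinvariant vectors kills it.\<close>

lemma invertible_one_minus_substochastic: "invertible (mat 1 - P)"
proof -
  have "y = 0" if y: "transpose (mat 1 - P) *v y = 0" for y
  proof -
    have eq: "y $ j = (\<Sum>i\<in>UNIV. y $ i * P $ i $ j)" for j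
      using vector_mult_one_minus[of y j] y by (simp add: vector_transpose_matrix)
    have "\<bar>y $ j\<bar> \<le> (\<Sum>i\<in>UNIV. \<bar>y $ i\<bar> * P $ i $ j)" for j
      by (subst eq) (rule order_trans[OF sum_abs], simp add: abs_mult P_nonneg)
    then have "\<bar>y $ i\<bar> = 0" for i
      by (intro substochastic_subinvariant_zero[where P = "\<lambda>i j. P $ i $ j"] P_row) auto
    then show ?thesis by (simp add: vec_eq_iff)
  qed
  then have "invertible (transpose (mat 1 - P))"
    by (metis invertible_left_inverse matrix_left_invertible_ker)
  then show ?thesis
    by (metis transpose_invertible transpose_transpose)
qed

text \<open>The negative part \<open>max 0 (- y $ i)\<close> is again subinvariant, hence zero. Thus
  \<open>y\<close> is nonnegative, and \<open>y = 1 + y v* P\<close> lifts the bound to 1.\<close>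

lemma one_le_if_one_minus_substochastic_eq_one:
  assumes "y v* (mat 1 - P) = 1"
  shows "1 \<le> y $ j"
proof -
  have eq: "y $ j = 1 + (\<Sum>i\<in>UNIV. y $ i * P $ i $ j)" for j
    using vector_mult_one_minus[of y j] assms by simp
  have "max 0 (- y $ j) \<le> (\<Sum>i\<in>UNIV. max 0 (- y $ i) * P $ i $ j)" for j
  proof -
    have "- y $ j \<le> (\<Sum>i\<in>UNIV. - y $ i * P $ i $ j)"
      using eq[of j] by (simp add: sum_negf)
    also have "\<dots> \<le> (\<Sum>i\<in>UNIV. max 0 (- y $ i) * P $ i $ j)"
      by (intro sum_mono mult_right_mono P_nonneg) auto
    finally show ?thesis
      by (simp add: sum_nonneg P_nonneg)
  qed
  then have "max 0 (- y $ i) = 0" for i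
    by (intro substochastic_subinvariant_zero[where P = "\<lambda>i j. P $ i $ j"] P_row) auto
  then have "0 \<le> y $ i" for i
    by (metis max.cobounded2 neg_le_0_iff_le)
  then show ?thesis
    using eq[of j] by (simp add: sum_nonneg P_nonneg)
qed

end

lemma c1_pos:
  fixes W :: "real ^ 'n ^ 'n"
  assumes W: "\<And>i j. 0 \<le> W $ i $ j" "W *v 1 = 1"
    and \<alpha>: "\<And>i. 0 < \<alpha> $ i" "\<And>i. \<alpha> $ i < 1"
  shows "0 < c1 W \<alpha> $ v"
proof -
  define P where "P = (mat 1 - diag_mat \<alpha>) ** W"
  have P: "P $ i $ j = (1 - \<alpha> $ i) * W $ i $ j" for i j
    by (simp add: P_def mat_1_minus_diag_mat diag_mat_mult)
  have nonneg: "0 \<le> P $ i $ j" for i j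
    using W(1) \<alpha>(2)[of i] by (simp add: P)
  have "(\<Sum>j\<in>UNIV. W $ i $ j) = 1" for i
    using W(2) by (simp add: matrix_vector_mult_def vec_eq_iff)
  then have row: "(\<Sum>j\<in>UNIV. P $ i $ j) < 1" for i
    using \<alpha>(1)[of i] by (simp add: P flip: sum_distrib_left)
  \<comment> \<open>\<open>matrix_inv\<close> is a Hilbert choice; invertibility guarantees that the
    chosen matrix really is an inverse, here used on the left.\<close>
  have "B_mat W \<alpha> ** (mat 1 - P) = mat 1"
    unfolding B_mat_def P_def[symmetric] matrix_inv_def
    using someI_ex[OF invertible_one_minus_substochastic[OF nonneg row, unfolded invertible_def]]
    by blast
  then have "(1 v* B_mat W \<alpha>) v* (mat 1 - P) = 1"
    by (simp add: vector_matrix_mul_assoc)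
  then have "1 \<le> (1 v* B_mat W \<alpha>) $ v"
    by (intro one_le_if_one_minus_substochastic_eq_one[where P = P] nonneg row)
  moreover have "c1 W \<alpha> $ v = (1 v* B_mat W \<alpha>) $ v * (1 - \<alpha> $ v)"
    by (simp add: c1_def mat_1_minus_diag_mat vector_matrix_mult_def mult_diag_mat
        sum_distrib_right mult.assoc)
  ultimately show ?thesis
    using \<alpha>(2)[of v] by (simp add: zero_less_mult_iff)
qed

section \<open>Influence as a function of the expressed opinion\<close>

lemma influence_ge:
  assumes "card T \<le> k"
  shows "(\<Sum>v\<in>T. c1 W \<alpha> $ v * (expressed W \<alpha> s $ u - c2 W \<alpha> s $ v)) \<le> influence W \<alpha> s k u"
  unfolding influence_def using assms by (intro Max_ge) auto

lemma influence_attained: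
  obtains T where "card T \<le> k"
    "influence W \<alpha> s k u = (\<Sum>v\<in>T. c1 W \<alpha> $ v * (expressed W \<alpha> s $ u - c2 W \<alpha> s $ v))"
proof -
  have "influence W \<alpha> s k u \<in> (\<lambda>T. \<Sum>v\<in>T. c1 W \<alpha> $ v * (expressed W \<alpha> s $ u - c2 W \<alpha> s $ v))
      ` {T. card T \<le> k}"
    unfolding influence_def by (rule Max_in) (auto intro: exI[of _ "{}"])
  with that show thesis by blast
qed

lemma influence_nonneg: "0 \<le> influence W \<alpha> s k u"
  using influence_ge[of "{}" k W \<alpha> s u] by simp

text \<open>A target set attaining the maximum for \<open>u\<close> is also a candidate for
  \<open>u'\<close>, and with positive weights each of its terms can only grow.\<close>

lemma influence_mono:
  assumes c1: "\<And>v. 0 < c1 W \<alpha> $ v" and le: "expressed W \<alpha> s $ u \<le> expressed W \<alpha> s $ u'"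
  shows "influence W \<alpha> s k u \<le> influence W \<alpha> s k u'"
proof -
  obtain T where T: "card T \<le> k"
    "influence W \<alpha> s k u = (\<Sum>v\<in>T. c1 W \<alpha> $ v * (expressed W \<alpha> s $ u - c2 W \<alpha> s $ v))"
    by (rule influence_attained)
  have "(\<Sum>v\<in>T. c1 W \<alpha> $ v * (expressed W \<alpha> s $ u - c2 W \<alpha> s $ v))
      \<le> (\<Sum>v\<in>T. c1 W \<alpha> $ v * (expressed W \<alpha> s $ u' - c2 W \<alpha> s $ v))"
    using le by (intro sum_mono mult_left_mono less_imp_le[OF c1]) auto
  also have "\<dots> \<le> influence W \<alpha> s k u'"
    by (rule influence_ge[OF T(1)])
  finally show ?thesis
    unfolding T(2) .
qed

text \<open>Positivity is what makes the maximising target set nonempty; an empty one would have sum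
  0 for \<open>u\<close> and \<open>u'\<close> alike, giving no strict gain.\<close>

lemma influence_strict_mono:
  assumes c1: "\<And>v. 0 < c1 W \<alpha> $ v" and less: "expressed W \<alpha> s $ u < expressed W \<alpha> s $ u'"
    and pos: "0 < influence W \<alpha> s k u"
  shows "influence W \<alpha> s k u < influence W \<alpha> s k u'"
proof -
  obtain T where T: "card T \<le> k"
    "influence W \<alpha> s k u = (\<Sum>v\<in>T. c1 W \<alpha> $ v * (expressed W \<alpha> s $ u - c2 W \<alpha> s $ v))"
    by (rule influence_attained)
  have "T \<noteq> {}"
    using pos T(2) by auto
  have "(\<Sum>v\<in>T. c1 W \<alpha> $ v * (expressed W \<alpha> s $ u - c2 W \<alpha> s $ v))
      < (\<Sum>v\<in>T. c1 W \<alpha> $ v * (expressed W \<alpha> s $ u' - c2 W \<alpha> s $ v))"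
    using less \<open>T \<noteq> {}\<close> by (intro sum_strict_mono mult_strict_left_mono c1) auto
  also have "\<dots> \<le> influence W \<alpha> s k u'"
    by (rule influence_ge[OF T(1)])
  finally show ?thesis
    unfolding T(2) .
qed

section \<open>Optimal sets and top users\<close>

text \<open>The elements of \<open>A - S\<close> are traded injectively for elements of
  \<open>S - A\<close> of no smaller value; what is left over in \<open>S\<close> contributes
  nonnegatively.\<close>

lemma sum_le_sum_dominating:
  fixes f :: "'a \<Rightarrow> real"
  assumes fin: "finite A" "finite S" and card: "card A \<le> card S"
    and nonneg: "\<And>u. 0 \<le> f u" and dom: "\<And>u v. u \<in> S \<Longrightarrow> v \<notin> S \<Longrightarrow> f v \<le> f u"
  shows "sum f A \<le> sum f S"
proof -
  have "card A = card (A \<inter> S) + card (A - S)" "card S = card (A \<inter> S) + card (S - A)"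
    using fin by (metis card_Int_Diff, metis card_Int_Diff inf_commute)
  with card have "card (A - S) \<le> card (S - A)"
    by linarith
  then obtain h where h: "h ` (A - S) \<subseteq> S - A" "inj_on h (A - S)"
    using fin card_le_inj[of "A - S" "S - A"] by auto
  have "sum f (A - S) \<le> (\<Sum>v\<in>A - S. f (h v))"
    using h(1) by (intro sum_mono dom) auto
  also have "\<dots> = sum f (h ` (A - S))"
    using h(2) by (simp add: sum.reindex)
  also have "\<dots> \<le> sum f (S - A)"
    using fin h(1) nonneg by (intro sum_mono2) auto
  finally show ?thesis
    using fin sum.Int_Diff[of A f S] sum.Int_Diff[of S f A] by (simp add: Int_commute)
qed

lemma top_users_card: "top_users z m S \<Longrightarrow> card S = m"
  unfolding top_users_def using distinct_card by blast

lemma top_users_dominating: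
  assumes "top_users z m S" "u \<in> S" "v \<notin> S"
  shows "z $ v \<le> z $ u"
proof -
  obtain us where us: "set us = S" "sorted_wrt (\<lambda>u v. z $ u \<ge> z $ v) us" "z $ v \<le> z $ last us"
    using assms by (auto simp: top_users_def)
  \<comment> \<open>Nonemptiness lets the last entry be split off, so that sortedness compares every
    other entry with it.\<close>
  with assms(2) have "us \<noteq> []" by auto
  then have "sorted_wrt (\<lambda>u v. z $ u \<ge> z $ v) (butlast us @ [last us])" "u \<in> set (butlast us @ [last us])"
    using us assms(2) by auto
  then have "z $ last us \<le> z $ u"
    unfolding sorted_wrt_append by auto
  with us(3) show ?thesis by linarith
qed

text \<open>Sorting \<open>A\<close> and its complement separately and listing \<open>A\<close>
  first gives, by domination, a sorted enumeration of all users. Its first \<open>m\<close> entries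
  form the required top set.\<close>

lemma top_users_extend:
  fixes A :: "'n::finite set"
  assumes "1 \<le> m" "m \<le> CARD('n)" "card A \<le> m"
    and dom: "\<And>u v. u \<in> A \<Longrightarrow> v \<notin> A \<Longrightarrow> z $ v \<le> z $ u"
  shows "\<exists>S. top_users z m S \<and> A \<subseteq> S"
proof -
  define R where "R = (\<lambda>u v. z $ u \<ge> z $ v)"
  have enum: "\<exists>xs. set xs = X \<and> distinct xs \<and> sorted_wrt R xs" for X :: "'n set"
  proof -
    obtain xs where "set xs = X" "distinct xs"
      using finite_distinct_list[of X] by auto
    \<comment> \<open>\<open>sort_key\<close> sorts upwards, hence the negated key.\<close>
    then show ?thesis
      using sorted_sort_key[of "\<lambda>u. - z $ u" xs]
      by (intro exI[of _ "sort_key (\<lambda>u. - z $ u) xs"]) (simp add: sorted_map R_def)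
  qed
  obtain xs where xs: "set xs = A" "distinct xs" "sorted_wrt R xs"
    using enum by blast
  obtain ys where ys: "set ys = - A" "distinct ys" "sorted_wrt R ys"
    using enum by blast
  define us where "us = xs @ ys"
  have us: "set us = UNIV" "distinct us" "sorted_wrt R us"
    using xs ys dom by (auto simp: us_def sorted_wrt_append R_def)
  then have len: "length us = CARD('n)"
    by (metis distinct_card)
  \<comment> \<open>This makes \<open>last\<close> of the prefix an actual entry of it.\<close>
  have ne: "take m us \<noteq> []"
    using assms(1,2) len by auto
  have split: "sorted_wrt R (take m us @ drop m us)"
    using us(3) by simp
  have "z $ v \<le> z $ last (take m us)" if "v \<notin> set (take m us)" for v
  proof -
    have "v \<in> set (take m us) \<union> set (drop m us)"
      using us(1) by (simp flip: set_append)
    with that have "v \<in> set (drop m us)"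
      by blast
    then show ?thesis
      using split last_in_set[OF ne] unfolding sorted_wrt_append R_def by blast
  qed
  moreover have "sorted_wrt (\<lambda>u v. z $ u \<ge> z $ v) (take m us)"
    using split unfolding sorted_wrt_append R_def by blast
  moreover have "length (take m us) = m"
    using len assms(2) by simp
  ultimately have "top_users z m (set (take m us))"
    unfolding top_users_def using us(2) distinct_take by blast
  moreover have "A \<subseteq> set (take m us)"
    using xs(1,2) assms(3) distinct_card[of xs] by (simp add: us_def)
  ultimately show ?thesis by blast
qed

text \<open>Exchanging \<open>u\<close> for \<open>v\<close> keeps the cardinality, so optimality
  bounds the influence of \<open>v\<close> by that of \<open>u\<close>. A larger opinion at
  \<open>v\<close> would contradict this by strict monotonicity, which is available because the
  influence of \<open>u\<close> is positive.\<close>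

lemma optimal_attackers_dominating:
  fixes W :: "real ^ 'n ^ 'n"
  assumes c1: "\<And>v. 0 < c1 W \<alpha> $ v"
    and opt: "optimal_attackers W \<alpha> s k m A" and pos: "\<And>u. u \<in> A \<Longrightarrow> 0 < influence W \<alpha> s k u"
    and u: "u \<in> A" and v: "v \<notin> A"
  shows "expressed W \<alpha> s $ v \<le> expressed W \<alpha> s $ u"
proof -
  let ?f = "influence W \<alpha> s k"
  have card: "card A \<le> m" and max: "\<And>A'. card A' \<le> m \<Longrightarrow> sum ?f A' \<le> sum ?f A"
    using opt by (auto simp: optimal_attackers_def is_arg_max_linorder)
  have "card (insert v (A - {u})) = card A"
    using u v card_Suc_Diff1[of A u] by simp
  with card have "sum ?f (insert v (A - {u})) \<le> sum ?f A"
    by (intro max) simp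
  then have "?f v \<le> ?f u"
    using u v by (simp add: sum_diff1)
  then show ?thesis
    using influence_strict_mono[OF c1, of s u v k] pos[OF u] by (meson linorder_not_le)
qed

text \<open>Ties and users of zero influence can make the optimal set non-unique, so the inclusion
  is stated in two ways: every top set contains some optimal set, and every optimal set made of
  users with positive influence lies in some top set.\<close>

theorem corollary1:
  fixes W :: "real ^ 'n ^ 'n" and \<alpha> s :: "real ^ 'n" and m k :: nat and S :: "'n set"
  assumes "1 \<le> m" and "m \<le> CARD('n)" and "1 \<le> k"
    and "\<And>i j. 0 \<le> W $ i $ j" and "W *v 1 = 1"
    and "\<And>i. 0 < \<alpha> $ i" and "\<And>i. \<alpha> $ i < 1"
    and "top_users (expressed W \<alpha> s) m S"
  shows "(\<exists>A. optimal_attackers W \<alpha> s k m A \<and> A \<subseteq> S) \<and>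
    (\<forall>A. optimal_attackers W \<alpha> s k m A \<and> (\<forall>u\<in>A. influence W \<alpha> s k u > 0) \<longrightarrow>
      (\<exists>S'. top_users (expressed W \<alpha> s) m S' \<and> A \<subseteq> S'))"
proof (intro conjI allI impI)
  have c1: "0 < c1 W \<alpha> $ v" for v
    using assms(4-7) by (rule c1_pos)
  \<comment> \<open>The witness for the first part is \<open>S\<close> itself, which is
    optimal.\<close>
  have "sum (influence W \<alpha> s k) A \<le> sum (influence W \<alpha> s k) S" if "card A \<le> m" for A
    using that top_users_card[OF assms(8)] top_users_dominating[OF assms(8)]
    by (intro sum_le_sum_dominating influence_nonneg influence_mono c1) auto
  then have "optimal_attackers W \<alpha> s k m S"
    using top_users_card[OF assms(8)] by (simp add: optimal_attackers_def is_arg_max_linorder)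
  then show "\<exists>A. optimal_attackers W \<alpha> s k m A \<and> A \<subseteq> S"
    by blast
  fix A
  assume A: "optimal_attackers W \<alpha> s k m A \<and> (\<forall>u\<in>A. influence W \<alpha> s k u > 0)"
  then have "card A \<le> m"
    by (simp add: optimal_attackers_def is_arg_max_def)
  with A show "\<exists>S'. top_users (expressed W \<alpha> s) m S' \<and> A \<subseteq> S'"
    by (intro top_users_extend assms(1,2) optimal_attackers_dominating[OF c1]) auto
qed

end
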